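(* Let $\rho\in\mathbb{N}$, and let $\alpha,\beta,\delta_1,\dots,\delta_\rho\in(-1,+\infty)$ and $\kappa_1,\dots,\kappa_\rho\in\mathbb{N}$ be arbitrary parameters. Put $\kappa=\kappa_1+\dots+\kappa_\rho$. Let $\widehat D=L(\delta_1,\kappa_1)L(\delta_2,\kappa_2)\cdots L(\delta_\rho,\kappa_\rho)=\sum_{j=0}^{\kappa}c_j(x)\frac{d^j}{dx^j}$, with polynomial coefficients $c_j(x)$, be the differential operator defined in the context, and let $$M(x)=(c_0(x),\dots,c_\kappa(x))^T(c_0(x),\dots,c_\kappa(x)),\qquad x\in\mathbb{R}.$$ For the polynomials $$\mathcal{P}_n(x)={}_{\rho+2}F_{\rho+1}(-n,n+\alpha+\beta+1,\delta_1+1,\dots,\delta_\rho+1;\alpha+1,\kappa_1+\delta_1+1,\dots,\kappa_\rho+\delta_\rho+1;x),$$ $$\mathcal{L}_n(x)={}_{\rho+1}F_{\rho+1}(-n,\delta_1+1,\dots,\delta_\rho+1;\alpha+1,\kappa_1+\delta_1+1,\dots,\kappa_\rho+\delta_\rho+1;x),\qquad n\in\mathbb{Z}_+,$$ the following relations hold for all $n,m\in\mathbb{Z}_+$: $$\int_0^1\left(\mathcal{P}_n(x),\mathcal{P}_n'(x),\dots,\mathcal{P}_n^{(\kappa)}(x)\right)M(x)\left(\mathcal{P}_m(x),\mathcal{P}_m'(x),\dots,\mathcal{P}_m^{(\kappa)}(x)\right)^T x^\alpha(1-x)^\beta\,dx=A_n\delta_{n,m},\qquad A_n>0;$$ $$\int_0^\infty\left(\mathcal{L}_n(x),\mathcal{L}_n'(x),\dots,\mathcal{L}_n^{(\kappa)}(x)\right)M(x)\left(\mathcal{L}_m(x),\mathcal{L}_m'(x),\dots,\mathcal{L}_m^{(\kappa)}(x)\right)^T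 x^\alpha e^{-x}\,dx=B_n\delta_{n,m},\qquad B_n>0,$$ where $A_n$, $B_n$ are some positive constants depending on $n$ (and the parameters), and $\delta_{n,m}$ is the Kronecker delta.
   Context: $\mathbb{N}$ is the set of positive integers, $\mathbb{Z}_+$ the set of non-negative integers. The Pochhammer symbol is $(c)_0=1$, $(c)_k=c(c+1)\cdots(c+k-1)$ for $k\ge1$. The generalized hypergeometric function is $${}_mF_n(a_1,\dots,a_m;b_1,\dots,b_n;x)=\sum_{k=0}^\infty\frac{(a_1)_k\cdots(a_m)_k}{(b_1)_k\cdots(b_n)_k}\frac{x^k}{k!};$$ when an upper parameter is $-n$ with $n\in\mathbb{Z}_+$ it is a polynomial in $x$ (sum over $0\le k\le n$). For $\delta>-1$ and $k\in\mathbb{N}$, $L(\delta,k)$ is the linear differential operator with polynomial coefficients defined on polynomials $y$ by $$L(\delta,k)\,y(x)=\frac{1}{(\delta+1)\cdots(\delta+k)}\,x^{-\delta}\left(x^{k+\delta}y(x)\right)^{(k)}$$ (computed for $x>0$; after expansion by the Leibniz rule the coefficients are polynomials in $x$, so the formula is extended to all $x$). The composition $\widehat D=L(\delta_1,\kappa_1)\cdots L(\delta_\rho,\kappa_\rho)$ is a linear differential operator of order $\kappa=\kappa_1+\dots+\kappa_\rho$ with polynomial coefficients, written $\widehat D=\sum_{j=0}^\kappa c_j(x)\frac{d^j}{dx^j}$, where $c_\kappa$ is not the null polynomial. $M^T$ denotes the transpose; $M(x)$ is a $(\kappa+1)\times(\kappa+1)$ matrix. *)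

theory Defs
  imports
    "HOL-Analysis.Analysis"
    "HOL-Computational_Algebra.Computational_Algebra"
    "Jordan_Normal_Form.Matrix"
begin

definition hypergeometric :: "real list \<Rightarrow> real list \<Rightarrow> real \<Rightarrow> real" where
  "hypergeometric as bs x = eval_fps (fps_hypergeo as bs 1) x"

lemma hypergeometric_series:
  "hypergeometric as bs x = (\<Sum>k. (\<Prod>a\<leftarrow>as. pochhammer a k)
       / (\<Prod>b\<leftarrow>bs. pochhammer b k) * x ^ k / fact k)"
proof -
  have "foldl (\<lambda>r a. r * pochhammer a k) v as = v * (\<Prod>a\<leftarrow>as. pochhammer a k)"
    for as :: "real list" and k v
    by (induction as arbitrary: v) (simp_all add: mult_ac)
  then show ?thesis by (simp add: hypergeometric_def eval_fps_def)
qed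

(* The defining formula only makes sense for x > 0; since its value there is a polynomial in x,
   L_op \<delta> k y is the polynomial extending it to all x. That it exists and is
   unique is proved with poly_L_op below. *)
definition L_op :: "real \<Rightarrow> nat \<Rightarrow> real poly \<Rightarrow> real poly" where
  "L_op \<delta> k y = (THE q. \<forall>x>0. poly q x =
     1 / pochhammer (\<delta> + 1) k * x powr (- \<delta>)
       * (deriv ^^ k) (\<lambda>t. t powr (real k + \<delta>) * poly y t) x)"

(* The parameters are indexed by 1..\<rho>: D_hat \<delta> \<kappa> \<rho> = L_op (\<delta> 1) (\<kappa> 1) \<circ> ... \<circ> L_op (\<delta> \<rho>) (\<kappa> \<rho>). *)
primrec D_hat :: "(nat \<Rightarrow> real) \<Rightarrow> (nat \<Rightarrow> nat) \<Rightarrow> nat \<Rightarrow> real poly \<Rightarrow> real poly" where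
  "D_hat \<delta> \<kappa> 0 = id"
| "D_hat \<delta> \<kappa> (Suc r) = D_hat \<delta> \<kappa> r \<circ> L_op (\<delta> (Suc r)) (\<kappa> (Suc r))"

definition is_diffop_coeffs :: "(real poly \<Rightarrow> real poly) \<Rightarrow> nat \<Rightarrow> (nat \<Rightarrow> real poly) \<Rightarrow> bool" where
  "is_diffop_coeffs D K c \<longleftrightarrow>
     (\<forall>y. D y = (\<Sum>j\<le>K. c j * (pderiv ^^ j) y)) \<and> c K \<noteq> 0 \<and> (\<forall>j>K. c j = 0)"

(* For D = D_hat \<delta> \<kappa> \<rho> and K = \<kappa> 1 + ... + \<kappa> \<rho> these coefficients exist and are unique, see
   is_diffop_coeffs_D_hat below. *)
definition diffop_coeffs :: "(real poly \<Rightarrow> real poly) \<Rightarrow> nat \<Rightarrow> nat \<Rightarrow> real poly" where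
  "diffop_coeffs D K = (THE c. is_diffop_coeffs D K c)"

definition M_mat :: "(nat \<Rightarrow> real poly) \<Rightarrow> nat \<Rightarrow> real \<Rightarrow> real Matrix.mat" where
  "M_mat c K x =
     (let C = Matrix.mat 1 (K + 1) (\<lambda>(_, j). poly (c j) x) in transpose_mat C * C)"

definition deriv_vec :: "nat \<Rightarrow> (real \<Rightarrow> real) \<Rightarrow> real \<Rightarrow> real Matrix.vec" where
  "deriv_vec K f x = Matrix.vec (K + 1) (\<lambda>j. (deriv ^^ j) f x)"

definition sobolev_form ::
    "(nat \<Rightarrow> real poly) \<Rightarrow> nat \<Rightarrow> (real \<Rightarrow> real) \<Rightarrow> (real \<Rightarrow> real) \<Rightarrow> real \<Rightarrow> real" where
  "sobolev_form c K f g x =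
     scalar_prod (deriv_vec K f x) (M_mat c K x *\<^sub>v deriv_vec K g x)"

definition P_fun :: "nat \<Rightarrow> real \<Rightarrow> real \<Rightarrow> (nat \<Rightarrow> real) \<Rightarrow> (nat \<Rightarrow> nat) \<Rightarrow> nat \<Rightarrow> real \<Rightarrow> real" where
  "P_fun \<rho> \<alpha> \<beta> \<delta> \<kappa> n = hypergeometric
     ([- real n, real n + \<alpha> + \<beta> + 1] @ map (\<lambda>i. \<delta> i + 1) [1..<\<rho> + 1])
     ([\<alpha> + 1] @ map (\<lambda>i. real (\<kappa> i) + \<delta> i + 1) [1..<\<rho> + 1])"

definition L_fun :: "nat \<Rightarrow> real \<Rightarrow> (nat \<Rightarrow> real) \<Rightarrow> (nat \<Rightarrow> nat) \<Rightarrow> nat \<Rightarrow> real \<Rightarrow> real" where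
  "L_fun \<rho> \<alpha> \<delta> \<kappa> n = hypergeometric
     ([- real n] @ map (\<lambda>i. \<delta> i + 1) [1..<\<rho> + 1])
     ([\<alpha> + 1] @ map (\<lambda>i. real (\<kappa> i) + \<delta> i + 1) [1..<\<rho> + 1])"

lemma higher_deriv_powr_sum:
  fixes a b :: "nat \<Rightarrow> real"
  assumes "x > 0"
  shows "(deriv ^^ k) (\<lambda>t. \<Sum>i\<le>d. b i * t powr a i) x
    = (\<Sum>i\<le>d. b i * pochhammer (a i - real k + 1) k * x powr (a i - real k))"
  using assms
proof (induction k arbitrary: x)
  case 0
  then show ?case by simp
next
  case (Suc k)
  have "eventually (\<lambda>t::real. t \<in> {0<..}) (nhds x)"
    using Suc.prems by (intro eventually_nhds_in_open) auto
  then have ev: "eventually (\<lambda>t. (deriv ^^ k) (\<lambda>t. \<Sum>i\<le>d. b i * t powr a i) t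
      = (\<Sum>i\<le>d. b i * pochhammer (a i - real k + 1) k * t powr (a i - real k))) (nhds x)"
    by eventually_elim (use Suc.IH in auto)
  have "((\<lambda>t. \<Sum>i\<le>d. b i * pochhammer (a i - real k + 1) k * t powr (a i - real k))
     has_field_derivative (\<Sum>i\<le>d. b i * pochhammer (a i - real k + 1) k *
       ((a i - real k) * x powr (a i - real k - 1)))) (at x)"
    using Suc.prems by (auto intro!: derivative_eq_intros sum.cong)
  then have "(deriv ^^ Suc k) (\<lambda>t. \<Sum>i\<le>d. b i * t powr a i) x = (\<Sum>i\<le>d. b i *
      pochhammer (a i - real k + 1) k * ((a i - real k) * x powr (a i - real k - 1)))"
    using deriv_cong_ev[OF ev refl] by (simp add: DERIV_imp_deriv)
  also have "\<dots> = (\<Sum>i\<le>d. b i * pochhammer (a i - real (Suc k) + 1) (Suc k)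
      * x powr (a i - real (Suc k)))"
    by (intro sum.cong refl) (simp add: pochhammer_rec algebra_simps)
  finally show ?case .
qed

lemma L_formula_monomials:
  assumes "x > 0"
  shows "1 / pochhammer (\<delta> + 1) k * x powr (- \<delta>)
       * (deriv ^^ k) (\<lambda>t. t powr (real k + \<delta>) * poly y t) x
    = poly (\<Sum>i\<le>degree y. monom (pochhammer (\<delta> + 1 + real i) k / pochhammer (\<delta> + 1) k * coeff y i) i) x"
proof -
  have "eventually (\<lambda>t::real. t \<in> {0<..}) (nhds x)"
    using assms by (intro eventually_nhds_in_open) auto
  then have ev: "eventually (\<lambda>t. t powr (real k + \<delta>) * poly y t
      = (\<Sum>i\<le>degree y. coeff y i * t powr (real k + \<delta> + real i))) (nhds x)"
    by eventually_elim
      (auto simp: poly_altdef sum_distrib_left powr_add powr_realpow intro!: sum.cong)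
  show ?thesis
    unfolding higher_deriv_cong_ev[OF ev refl] higher_deriv_powr_sum[OF assms]
      poly_sum poly_monom sum_distrib_left
    using assms
    by (intro sum.cong refl) (simp add: powr_add powr_minus powr_realpow field_simps)
qed

lemma coeff_L_op:
  "coeff (L_op \<delta> k y) i = pochhammer (\<delta> + 1 + real i) k / pochhammer (\<delta> + 1) k * coeff y i"
  and poly_L_op: "x > 0 \<Longrightarrow> poly (L_op \<delta> k y) x =
     1 / pochhammer (\<delta> + 1) k * x powr (- \<delta>)
       * (deriv ^^ k) (\<lambda>t. t powr (real k + \<delta>) * poly y t) x"
proof -
  let ?q = "\<Sum>i\<le>degree y. monom (pochhammer (\<delta> + 1 + real i) k / pochhammer (\<delta> + 1) k * coeff y i) i"
  have L: "L_op \<delta> k y = ?q"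
    unfolding L_op_def
  proof (rule the_equality)
    fix q assume q: "\<forall>x>0. poly q x = 1 / pochhammer (\<delta> + 1) k * x powr (- \<delta>)
       * (deriv ^^ k) (\<lambda>t. t powr (real k + \<delta>) * poly y t) x"
    have "{0<..} \<subseteq> {x. poly (q - ?q) x = 0}"
      using q L_formula_monomials by auto
    moreover have "infinite {0::real<..}" by (rule infinite_Ioi)
    ultimately have "infinite {x. poly (q - ?q) x = 0}" using finite_subset by blast
    then have "q - ?q = 0" using poly_roots_finite by blast
    then show "q = ?q" by simp
  qed (use L_formula_monomials in auto)
  show "coeff (L_op \<delta> k y) i = pochhammer (\<delta> + 1 + real i) k / pochhammer (\<delta> + 1) k * coeff y i"
    unfolding L coeff_sum coeff_monom by (auto simp: coeff_eq_0)
  show "x > 0 \<Longrightarrow> poly (L_op \<delta> k y) x =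
     1 / pochhammer (\<delta> + 1) k * x powr (- \<delta>)
       * (deriv ^^ k) (\<lambda>t. t powr (real k + \<delta>) * poly y t) x"
    unfolding L by (rule L_formula_monomials[symmetric])
qed

lemma ex_D_hat_symbol:
  assumes "\<And>i. i \<in> {1..r} \<Longrightarrow> \<delta> i > -1"
  shows "\<exists>Q. degree Q = (\<Sum>i=1..r. \<kappa> i) \<and> Q \<noteq> 0 \<and>
    (\<forall>y i. coeff (D_hat \<delta> \<kappa> r y) i = poly Q (real i) * coeff y i)"
  using assms
proof (induction r)
  case 0
  show ?case by (intro exI[of _ 1]) auto
next
  case (Suc r)
  then obtain Q where Q: "degree Q = (\<Sum>i=1..r. \<kappa> i)" "Q \<noteq> 0"
    "\<And>y i. coeff (D_hat \<delta> \<kappa> r y) i = poly Q (real i) * coeff y i" by auto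
  let ?d = "\<delta> (Suc r)" and ?k = "\<kappa> (Suc r)"
  let ?R = "Polynomial.smult (1 / pochhammer (?d + 1) ?k) (\<Prod>l<?k. [:?d + 1 + real l, 1:])"
  have pos: "pochhammer (?d + 1) ?k > 0"
    using Suc.prems[of "Suc r"] by (intro pochhammer_pos) auto
  have R: "degree ?R = ?k" "?R \<noteq> 0" "\<And>x. poly ?R x = pochhammer (?d + 1 + x) ?k / pochhammer (?d + 1) ?k"
  proof -
    have "pochhammer (?d + 1) ?k \<noteq> 0" using pos by simp
    moreover have "(\<Prod>l<?k. [:?d + 1 + real l, 1:]) \<noteq> 0" by (simp add: prod_zero_iff)
    ultimately show "?R \<noteq> 0" by (simp only: smult_eq_0_iff) simp
    show "degree ?R = ?k"
      using \<open>pochhammer (?d + 1) ?k \<noteq> 0\<close> by (simp add: degree_prod_sum_eq)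
    show "poly ?R x = pochhammer (?d + 1 + x) ?k / pochhammer (?d + 1) ?k" for x
      by (simp add: poly_prod pochhammer_prod atLeast0LessThan algebra_simps)
  qed
  show ?case
    using Q R(1,2) by (intro exI[of _ "Q * ?R"])
      (simp add: degree_mult_eq coeff_L_op R(3) del: smult_eq_0_iff poly_smult degree_smult_eq mult_smult_right)
qed

lemma falling_factorial_expansion:
  fixes Q :: "real poly"
  assumes "degree Q \<le> K"
  shows "\<exists>a. Q = (\<Sum>j\<le>K. Polynomial.smult (a j) (\<Prod>l<j. [:- real l, 1:])) \<and> a K = coeff Q K"
  using assms
proof (induction K arbitrary: Q)
  case 0
  then obtain c where "Q = [:c:]" by (metis degree_eq_zeroE le_zero_eq)
  then show ?case by (intro exI[of _ "\<lambda>_. c"]) auto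
next
  case (Suc K)
  let ?F = "\<Prod>l<Suc K. [:- real l, 1:]"
  let ?R = "Q - Polynomial.smult (coeff Q (Suc K)) ?F"
  have F: "degree ?F = Suc K" by (subst degree_prod_sum_eq) auto
  have "lead_coeff ?F = 1" by (subst lead_coeff_prod) auto
  then have "coeff ?R (Suc K) = 0" using F by simp
  moreover have "degree ?R \<le> Suc K"
    using Suc.prems F by (intro degree_diff_le) (auto simp del: prod.lessThan_Suc)
  ultimately have "degree ?R \<le> K"
    using eq_zero_or_degree_less[of ?R "Suc K"] by auto
  from Suc.IH[OF this] obtain a where
    a: "?R = (\<Sum>j\<le>K. Polynomial.smult (a j) (\<Prod>l<j. [:- real l, 1:]))" by blast
  show ?case
    using a unfolding diff_eq_eq
    by (intro exI[of _ "a(Suc K := coeff Q (Suc K))"]) (simp del: prod.lessThan_Suc)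
qed

lemma is_diffop_coeffs_unique:
  assumes "is_diffop_coeffs D K c" "is_diffop_coeffs D K c'"
  shows "c = c'"
proof
  fix j
  show "c j = c' j"
  proof (induction j rule: less_induct)
    case (less j)
    show ?case
    proof (cases "j \<le> K")
      case True
      let ?t = "\<lambda>i. (pderiv ^^ i) (monom (1::real) j)"
      have hi: "?t i = 0" if "i > j" for i
        using that by (intro poly_eqI) (auto simp: coeff_higher_pderiv)
      have nz: "?t j \<noteq> 0"
      proof -
        have "coeff (?t j) 0 \<noteq> 0" by (simp add: coeff_higher_pderiv pochhammer_eq_0_iff)
        then show ?thesis by auto
      qed
      have "(\<Sum>i\<le>K. c i * ?t i) = (\<Sum>i\<le>K. c' i * ?t i)"
        using assms unfolding is_diffop_coeffs_def by metis
      then have "0 = (\<Sum>i\<le>K. (c i - c' i) * ?t i)"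
        by (simp add: left_diff_distrib sum_subtractf)
      also have "\<dots> = (\<Sum>i\<in>{j}. (c i - c' i) * ?t i)"
        using True hi less by (intro sum.mono_neutral_right) (auto, metis linorder_neqE_nat)
      finally show ?thesis using nz by simp
    qed (use assms in \<open>simp add: is_diffop_coeffs_def\<close>)
  qed
qed

(* D_hat acts diagonally on monomials, x^i \<mapsto> Q(i) x^i with a polynomial Q of degree K, and the
   falling factorial i (i - 1) ... (i - j + 1) is the eigenvalue of x^j d^j/dx^j. *)
lemma is_diffop_coeffs_D_hat:
  assumes "\<And>i. i \<in> {1..r} \<Longrightarrow> \<delta> i > -1" and "K = (\<Sum>i=1..r. \<kappa> i)"
  shows "is_diffop_coeffs (D_hat \<delta> \<kappa> r) K (diffop_coeffs (D_hat \<delta> \<kappa> r) K)"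
proof -
  obtain Q where Q: "degree Q = K" "Q \<noteq> 0"
    "\<And>y i. coeff (D_hat \<delta> \<kappa> r y) i = poly Q (real i) * coeff y i"
    using ex_D_hat_symbol[of r \<delta> \<kappa>] assms by blast
  obtain a where a: "Q = (\<Sum>j\<le>K. Polynomial.smult (a j) (\<Prod>l<j. [:- real l, 1:]))" "a K = coeff Q K"
    using falling_factorial_expansion[of Q K] Q(1) by auto
  have ff: "(\<Prod>l<j. real i - real l) =
      (if j \<le> i then pochhammer (real (Suc (i - j))) j else 0)" for i j
  proof (cases "j \<le> i")
    case True
    have "(\<Prod>l<j. real i - real l) = (\<Prod>l<j. real (i - j) + 1 + real l)"
      by (rule prod.reindex_bij_witness[of _ "\<lambda>l. j - 1 - l" "\<lambda>l. j - 1 - l"])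
        (use True in \<open>auto simp: of_nat_diff\<close>)
    then show ?thesis using True by (simp add: pochhammer_prod atLeast0LessThan add_ac)
  qed auto
  let ?c = "\<lambda>j. if j \<le> K then monom (a j) j else 0"
  have "D_hat \<delta> \<kappa> r y = (\<Sum>j\<le>K. ?c j * (pderiv ^^ j) y)" for y
  proof (rule poly_eqI)
    fix i
    have "coeff (D_hat \<delta> \<kappa> r y) i = (\<Sum>j\<le>K. a j * (\<Prod>l<j. real i - real l)) * coeff y i"
      unfolding Q(3) by (subst a(1)) (simp add: poly_sum poly_prod)
    also have "\<dots> = coeff (\<Sum>j\<le>K. ?c j * (pderiv ^^ j) y) i"
      unfolding coeff_sum sum_distrib_right
      by (intro sum.cong refl)
        (auto simp: ff coeff_monom_mult coeff_higher_pderiv simp del: of_nat_Suc)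
    finally show "coeff (D_hat \<delta> \<kappa> r y) i = coeff (\<Sum>j\<le>K. ?c j * (pderiv ^^ j) y) i" .
  qed
  moreover have "?c K \<noteq> 0" using a(2) Q(1,2) by (auto simp: monom_eq_0_iff)
  ultimately have "is_diffop_coeffs (D_hat \<delta> \<kappa> r) K ?c"
    unfolding is_diffop_coeffs_def by simp
  then show ?thesis
    unfolding diffop_coeffs_def by (metis theI is_diffop_coeffs_unique)
qed

end

(* The operator D_hat multiplies the coefficient of x^k by the product of the ratios
   (\<kappa>_i + \<delta>_i + 1)_k / (\<delta>_i + 1)_k, so it cancels the extra parameters of P_n and L_n and turns
   them into the Jacobi and Laguerre polynomials. Since M has rank one, the Sobolev form of f and g
   is the product of D_hat f and D_hat g, and the claim becomes classical orthogonality. For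
   the latter, P_n is integrated against the powers of 1 - x (Jacobi) or x (Laguerre): the moments
   are Beta or Gamma values, and the resulting sum is evaluated by the Chu-Vandermonde identity. *)
theory Submission
  imports Defs
begin

section \<open>Terminating hypergeometric series as polynomials\<close>

text \<open>The upper parameter -n is passed as the natural number \<open>n\<close>, so
  \<open>as\<close> lists only the other ones. Stopping at n loses nothing, as (-n)_k = 0 for k >
  n.\<close>

definition hyp_poly :: "nat \<Rightarrow> real list \<Rightarrow> real list \<Rightarrow> real poly" where
  "hyp_poly n as bs = (\<Sum>k\<le>n. monom ((\<Prod>a\<leftarrow>- real n # as. pochhammer a k)
       / (\<Prod>b\<leftarrow>bs. pochhammer b k) / fact k) k)"

lemma coeff_hyp_poly:
  "coeff (hyp_poly n as bs) k = (\<Prod>a\<leftarrow>- real n # as. pochhammer a k)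
       / (\<Prod>b\<leftarrow>bs. pochhammer b k) / fact k"
  by (cases "k \<le> n") (auto simp: hyp_poly_def coeff_sum pochhammer_of_nat_eq_0_iff)

lemma degree_hyp_poly_le: "degree (hyp_poly n as bs) \<le> n"
  by (rule degree_le) (simp add: coeff_hyp_poly pochhammer_of_nat_eq_0_iff)

lemma hypergeometric_eq_poly:
  "hypergeometric (- real n # as) bs = poly (hyp_poly n as bs)"
proof
  fix x
  have "hypergeometric (- real n # as) bs x = (\<Sum>k\<le>n. (\<Prod>a\<leftarrow>- real n # as. pochhammer a k)
       / (\<Prod>b\<leftarrow>bs. pochhammer b k) * x ^ k / fact k)"
    unfolding hypergeometric_series
    by (rule suminf_finite) (auto simp: pochhammer_of_nat_eq_0_iff)
  then show "hypergeometric (- real n # as) bs x = poly (hyp_poly n as bs) x"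
    by (simp add: hyp_poly_def poly_sum poly_monom)
qed

section \<open>The action of \<open>D_hat\<close> on coefficients\<close>

text \<open>Both (d)_i (d+i)_k and (d)_k (d+k)_i equal (d)_(i+k). This turns the eigenvalue of
  \<open>L_op\<close> on x^i, built from symbols of fixed length k, into a ratio of symbols of
  length i, as in hypergeometric coefficients.\<close>

lemma pochhammer_shift_ratio:
  fixes d :: real
  assumes "d > 0"
  shows "pochhammer (d + real i) k / pochhammer d k = pochhammer (real k + d) i / pochhammer d i"
proof -
  have "pochhammer d i * pochhammer (d + real i) k = pochhammer d k * pochhammer (d + real k) i"
    by (simp flip: pochhammer_product' add: add.commute)
  then show ?thesis
    using pochhammer_pos[OF assms, of i] pochhammer_pos[OF assms, of k]
    by (simp add: divide_simps add.commute mult.commute)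
qed

lemma coeff_D_hat:
  assumes "\<And>i. i \<in> {1..r} \<Longrightarrow> \<delta> i > -1"
  shows "coeff (D_hat \<delta> \<kappa> r y) i =
    (\<Prod>l\<leftarrow>[1..<r + 1]. pochhammer (real (\<kappa> l) + \<delta> l + 1) i)
      / (\<Prod>l\<leftarrow>[1..<r + 1]. pochhammer (\<delta> l + 1) i) * coeff y i"
  using assms
proof (induction r arbitrary: y)
  case (Suc r)
  have "coeff (L_op (\<delta> (Suc r)) (\<kappa> (Suc r)) y) i =
      pochhammer (real (\<kappa> (Suc r)) + \<delta> (Suc r) + 1) i / pochhammer (\<delta> (Suc r) + 1) i * coeff y i"
    unfolding coeff_L_op
    by (subst pochhammer_shift_ratio) (use Suc.prems[of "Suc r"] in \<open>auto simp: add_ac\<close>)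
  moreover have "[1..<Suc r + 1] = [1..<r + 1] @ [Suc r]"
    by simp
  ultimately show ?case
    using Suc.IH Suc.prems by (simp add: mult_ac del: upt_Suc)
qed simp

text \<open>The eigenvalue on x^k is the reciprocal of what the appended parameters contribute to
  the coefficient of x^k; \<delta>_i > -1 makes all these symbols nonzero, so they cancel.\<close>

lemma D_hat_hyp_poly:
  assumes "\<And>i. i \<in> {1..r} \<Longrightarrow> \<delta> i > -1"
  shows "D_hat \<delta> \<kappa> r (hyp_poly n (as @ map (\<lambda>i. \<delta> i + 1) [1..<r + 1])
    (bs @ map (\<lambda>i. real (\<kappa> i) + \<delta> i + 1) [1..<r + 1])) = hyp_poly n as bs"
proof (rule poly_eqI)
  fix k
  have "(\<Prod>l\<leftarrow>[1..<r + 1]. pochhammer (real (\<kappa> l) + \<delta> l + 1) k) \<noteq> 0"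
    "(\<Prod>l\<leftarrow>[1..<r + 1]. pochhammer (\<delta> l + 1) k) \<noteq> 0"
    using assms by (fastforce simp: prod_list_zero_iff pochhammer_eq_0_iff)+
  then show "coeff (D_hat \<delta> \<kappa> r (hyp_poly n (as @ map (\<lambda>i. \<delta> i + 1) [1..<r + 1])
    (bs @ map (\<lambda>i. real (\<kappa> i) + \<delta> i + 1) [1..<r + 1]))) k = coeff (hyp_poly n as bs) k"
    unfolding coeff_hyp_poly
    by (subst coeff_D_hat[OF assms]) (simp_all add: coeff_hyp_poly o_def del: upt_Suc)
qed

section \<open>The Sobolev form on polynomials\<close>

lemma higher_deriv_poly: "(deriv ^^ j) (poly p) = poly ((pderiv ^^ j) p)"
proof (induction j)
  case (Suc j)
  then show ?case by (auto simp: DERIV_imp_deriv)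
qed simp

text \<open>M is C^T C for the row C of values c_j(x), and C times the vector of derivatives of p is
  the value of \<open>D p\<close>; so the double sum factors.\<close>

lemma sobolev_form_poly:
  assumes "is_diffop_coeffs D K c"
  shows "sobolev_form c K (poly p) (poly q) x = poly (D p * D q) x"
proof -
  have D: "poly (D y) x = (\<Sum>j\<le>K. poly (c j) x * poly ((pderiv ^^ j) y) x)" for y
    using assms by (simp add: is_diffop_coeffs_def poly_sum)
  have "sobolev_form c K (poly p) (poly q) x =
      (\<Sum>i\<le>K. \<Sum>j\<le>K. (poly (c i) x * poly ((pderiv ^^ i) p) x)
        * (poly (c j) x * poly ((pderiv ^^ j) q) x))"
    unfolding sobolev_form_def
    by (simp add: M_mat_def Let_def deriv_vec_def higher_deriv_poly scalar_prod_def mult_mat_vec_def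
        sum_distrib_left atLeast0LessThan lessThan_Suc_atMost mult_ac)
  then show ?thesis by (simp add: D sum_product)
qed

section \<open>Orthogonality deduced from orthogonality to powers\<close>

text \<open>Only the x^n term of p reaches x^n under an affine substitution. A degree bound is
  assumed because that is what \<open>degree_hyp_poly_le\<close> supplies.\<close>

lemma coeff_pcompose_affine_top:
  fixes p :: "real poly"
  assumes "degree p \<le> n" "b \<noteq> 0"
  shows "coeff (pcompose p [:a, b:]) n = b ^ n * coeff p n"
proof (cases "degree p = n")
  case True
  then show ?thesis
    using lead_coeff_comp[of "[:a, b:]" p] assms by (simp add: degree_pcompose mult.commute)
next
  case False
  then show ?thesis
    using assms by (simp add: coeff_eq_0 degree_pcompose)
qed

(* An involution q of degree at most 1 (here x or 1 - x) makes the powers of q a basis in which the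
   coefficients of p are those of pcompose p q. *)
lemma orthogonal_if_orthogonal_to_powers:
  fixes J :: "real poly \<Rightarrow> real" and P :: "nat \<Rightarrow> real poly"
  assumes add: "\<And>p q. J (p + q) = J p + J q" and smult: "\<And>a p. J (Polynomial.smult a p) = a * J p"
    and q: "pcompose q q = [:0, 1:]" "degree q \<le> 1"
    and deg: "\<And>n. degree (P n) \<le> n"
    and orth: "\<And>n j. j < n \<Longrightarrow> J (q ^ j * P n) = 0"
    and pos: "\<And>n. coeff (pcompose (P n) q) n * J (q ^ n * P n) > 0"
  shows "n \<noteq> m \<Longrightarrow> J (P n * P m) = 0" and "J (P n * P n) > 0"
proof -
  have J_sum: "J (\<Sum>j\<le>m. f j) = (\<Sum>j\<le>m. J (f j))" for m :: nat and f
    by (induction m) (simp_all add: add)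
  have expand: "J (P m * P n) = (\<Sum>j\<le>m. coeff (pcompose (P m) q) j * J (q ^ j * P n))" for m n
  proof -
    have "degree (pcompose (P m) q) \<le> m"
      using degree_pcompose_le[of "P m" q] deg[of m] mult_le_mono[OF deg[of m] q(2)] by simp
    then have "pcompose (P m) q = (\<Sum>j\<le>m. monom (coeff (pcompose (P m) q) j) j)"
      by (simp add: poly_as_sum_of_monoms')
    \<comment> \<open>Composing with q again undoes the first substitution and turns x^j into
      q^j.\<close>
    then have "pcompose (pcompose (P m) q) q = (\<Sum>j\<le>m. pcompose (monom (coeff (pcompose (P m) q) j) j) q)"
      by (metis pcompose_sum)
    also have "\<dots> = (\<Sum>j\<le>m. Polynomial.smult (coeff (pcompose (P m) q) j) (q ^ j))"
      by (intro sum.cong refl poly_ext) (simp add: poly_pcompose poly_monom)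
    also have "pcompose (pcompose (P m) q) q = P m"
      by (simp flip: pcompose_assoc add: q)
    finally have "J (P m * P n) = J ((\<Sum>j\<le>m. Polynomial.smult (coeff (pcompose (P m) q) j) (q ^ j)) * P n)"
      by simp
    then show ?thesis by (simp add: sum_distrib_right J_sum smult)
  qed
  have less: "J (P m * P n) = 0" if "m < n" for m n
    unfolding expand using that by (intro sum.neutral) (auto simp: orth)
  show "J (P n * P m) = 0" if "n \<noteq> m"
    using less[of n m] less[of m n] that by (cases n m rule: linorder_cases) (auto simp: mult.commute)
  \<comment> \<open>Only j = n survives, and its term is the quantity assumed positive.\<close>
  have "J (P n * P n) = (\<Sum>j\<in>{n}. coeff (pcompose (P n) q) j * J (q ^ j * P n))"
    unfolding expand by (intro sum.mono_neutral_right) (auto simp: orth)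
  then show "J (P n * P n) > 0" using pos by simp
qed

section \<open>Beta and Gamma moments as Lebesgue integrals\<close>

text \<open>The Beta and Gamma integrals enter as gauge integrals, the theorem uses Lebesgue
  integrals. For a nonnegative integrand the former yields integrability and the same value for the
  latter.\<close>

lemma set_integral_lborel_nonneg:
  fixes f :: "real \<Rightarrow> real"
  assumes [measurable]: "f \<in> borel_measurable borel" "S \<in> sets borel"
    and nonneg: "\<And>x. x \<in> S \<Longrightarrow> f x \<ge> 0" and I: "(f has_integral I) S"
  shows "set_integrable lborel S f" and "(LBINT x:S. f x) = I"
proof -
  have I0: "I \<ge> 0" using has_integral_nonneg[OF I nonneg] .
  have nn: "(\<integral>\<^sup>+x. ennreal (indicator S x * f x) \<partial>lborel) = ennreal I"
    using nn_integral_has_integral_lebesgue[OF nonneg I] by simp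
  show *: "set_integrable lborel S f"
    unfolding set_integrable_def
    by (rule integrableI_nn_integral_finite[where x = I])
      (use nonneg I0 nn in \<open>auto simp: indicator_def\<close>)
  show "(LBINT x:S. f x) = I"
    using set_borel_integral_eq_integral(2)[OF *] I by (simp add: integral_unique)
qed

lemma set_integral_weighted_poly:
  assumes moment: "\<And>k. set_integrable lborel S (\<lambda>x. x ^ k * g x :: real)"
  shows "set_integrable lborel S (\<lambda>x. poly p x * g x)"
    and "(LBINT x:S. poly p x * g x) = (\<Sum>k\<le>degree p. coeff p k * (LBINT x:S. x ^ k * g x))"
proof -
  have eq: "indicator S x *\<^sub>R (poly p x * g x) =
      (\<Sum>k\<le>degree p. coeff p k * (indicator S x *\<^sub>R (x ^ k * g x)))" for x
    by (simp add: poly_altdef sum_distrib_left sum_distrib_right mult_ac)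
  show "set_integrable lborel S (\<lambda>x. poly p x * g x)"
    using moment unfolding set_integrable_def eq
    by (intro Bochner_Integration.integrable_sum integrable_mult_right)
  show "(LBINT x:S. poly p x * g x) = (\<Sum>k\<le>degree p. coeff p k * (LBINT x:S. x ^ k * g x))"
    using moment unfolding set_integrable_def set_lebesgue_integral_def eq
    by (subst Bochner_Integration.integral_sum) auto
qed

text \<open>Euler's integral. The factors are grouped so that (1 - x)^j times the weight can serve
  as the function g of \<open>set_integral_weighted_poly\<close>.\<close>

lemma Beta_moments:
  fixes \<alpha> \<beta> :: real
  assumes "\<alpha> > -1" "\<beta> > -1"
  shows "set_integrable lborel {0<..<1} (\<lambda>x. x ^ k * ((1 - x) ^ j * (x powr \<alpha> * (1 - x) powr \<beta>)))"
    and "(LBINT x:{0<..<1}. x ^ k * ((1 - x) ^ j * (x powr \<alpha> * (1 - x) powr \<beta>)))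
      = Beta (\<alpha> + 1 + real k) (\<beta> + 1 + real j)"
proof -
  have "((\<lambda>x. x powr (\<alpha> + real k) * (1 - x) powr (\<beta> + real j)) has_integral
      Beta (\<alpha> + 1 + real k) (\<beta> + 1 + real j)) {0<..<1}"
    using has_integral_Beta_real[of "\<alpha> + 1 + real k" "\<beta> + 1 + real j"] assms
    by (simp add: has_integral_Icc_iff_Ioo add_ac)
  \<comment> \<open>On the open interval x and 1 - x are positive, as \<open>powr_realpow\<close>
    requires.\<close>
  then have I: "((\<lambda>x. x ^ k * ((1 - x) ^ j * (x powr \<alpha> * (1 - x) powr \<beta>))) has_integral
      Beta (\<alpha> + 1 + real k) (\<beta> + 1 + real j)) {0<..<1}"
    by (rule has_integral_eq[rotated]) (simp add: powr_add powr_realpow)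
  note * = set_integral_lborel_nonneg[OF _ _ _ I]
  show "set_integrable lborel {0<..<1} (\<lambda>x. x ^ k * ((1 - x) ^ j * (x powr \<alpha> * (1 - x) powr \<beta>)))"
    "(LBINT x:{0<..<1}. x ^ k * ((1 - x) ^ j * (x powr \<alpha> * (1 - x) powr \<beta>)))
      = Beta (\<alpha> + 1 + real k) (\<beta> + 1 + real j)"
    by (rule *; simp)+
qed

lemma Gamma_moments:
  fixes \<alpha> :: real
  assumes "\<alpha> > -1"
  shows "set_integrable lborel {0<..} (\<lambda>x. x ^ k * (x powr \<alpha> * exp (- x)))"
    and "(LBINT x:{0<..}. x ^ k * (x powr \<alpha> * exp (- x))) = Gamma (\<alpha> + 1 + real k)"
proof -
  have "((\<lambda>x. x powr (\<alpha> + real k) / exp x) has_integral Gamma (\<alpha> + 1 + real k)) {0..}"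
    using Gamma_integral_real[of "\<alpha> + 1 + real k"] assms by (simp add: add_ac)
  \<comment> \<open>The null set {0} is dropped so that \<open>powr_realpow\<close> applies on the
    whole domain.\<close>
  then have "((\<lambda>x. x powr (\<alpha> + real k) / exp x) has_integral Gamma (\<alpha> + 1 + real k)) {0<..}"
    by (subst has_integral_spike_set_eq[of _ "{0..}"]) (auto intro: negligible_subset[of "{0}"])
  then have I: "((\<lambda>x. x ^ k * (x powr \<alpha> * exp (- x))) has_integral Gamma (\<alpha> + 1 + real k)) {0<..}"
    by (rule has_integral_eq[rotated]) (simp add: powr_add powr_realpow exp_minus field_simps)
  note * = set_integral_lborel_nonneg[OF _ _ _ I]
  show "set_integrable lborel {0<..} (\<lambda>x. x ^ k * (x powr \<alpha> * exp (- x)))"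
    "(LBINT x:{0<..}. x ^ k * (x powr \<alpha> * exp (- x))) = Gamma (\<alpha> + 1 + real k)"
    by (rule *; simp)+
qed

section \<open>Integrals against powers by the Chu-Vandermonde identity\<close>

text \<open>With \<mu> the moments, the last hypothesis says that the integral is C times 2F1(a, -n;
  c; 1), which Chu-Vandermonde evaluates.\<close>

lemma sum_hyp_poly_Vandermonde:
  assumes "degree p \<le> n" "c > 0"
    and "\<And>k. k \<le> n \<Longrightarrow> coeff p k * \<mu> k =
      C * (pochhammer (a :: real) k * pochhammer (- real n) k / (fact k * pochhammer c k))"
  shows "(\<Sum>k\<le>degree p. coeff p k * \<mu> k) = C * (pochhammer (c - a) n / pochhammer c n)"
proof -
  have "(\<Sum>k\<le>degree p. coeff p k * \<mu> k) = (\<Sum>k\<le>n. coeff p k * \<mu> k)"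
    by (intro sum.mono_neutral_left) (use assms in \<open>auto simp: coeff_eq_0\<close>)
  also have "\<dots> = (\<Sum>k=0..n. C * (pochhammer a k * pochhammer (- real n) k / (fact k * pochhammer c k)))"
    by (intro sum.cong) (use assms in auto)
  also have "\<dots> = C * (pochhammer (c - a) n / pochhammer c n)"
    using Vandermonde_pochhammer[of n c a] assms(2) by (subst sum_distrib_left[symmetric]) simp
  finally show ?thesis .
qed

lemma pochhammer_Gamma_real:
  assumes "z > (0 :: real)"
  shows "Gamma (z + real k) = Gamma z * pochhammer z k"
proof -
  have "z \<notin> \<int>\<^sub>\<le>\<^sub>0"
    using assms by (auto elim!: nonpos_Ints_cases)
  then show ?thesis
    using pochhammer_Gamma[of z k] Gamma_real_pos[OF assms] by simp
qed

text \<open>The factor (1 - x)^j only shifts \<beta>, so the moments are proportional to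
  (\<alpha>+1)_k / (\<alpha>+\<beta>+2+j)_k: the numerator cancels the lower parameter and a 2F1 at
  1 remains. Powers of x would give a 3F2.\<close>

lemma Jacobi_hyp_poly_power_integral:
  fixes \<alpha> \<beta> :: real
  assumes "\<alpha> > -1" "\<beta> > -1"
  shows "(LBINT x:{0<..<1}. poly (hyp_poly n [real n + \<alpha> + \<beta> + 1] [\<alpha> + 1]) x
        * ((1 - x) ^ j * (x powr \<alpha> * (1 - x) powr \<beta>)))
     = Beta (\<alpha> + 1) (\<beta> + 1 + real j) * (pochhammer (1 + real j - real n) n
        / pochhammer (\<alpha> + \<beta> + 2 + real j) n)"
proof -
  have "(LBINT x:{0<..<1}. poly (hyp_poly n [real n + \<alpha> + \<beta> + 1] [\<alpha> + 1]) x
        * ((1 - x) ^ j * (x powr \<alpha> * (1 - x) powr \<beta>)))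
     = Beta (\<alpha> + 1) (\<beta> + 1 + real j) * (pochhammer (\<alpha> + \<beta> + 2 + real j - (real n + \<alpha> + \<beta> + 1)) n
        / pochhammer (\<alpha> + \<beta> + 2 + real j) n)"
    unfolding set_integral_weighted_poly(2)[OF Beta_moments(1)[OF assms]] Beta_moments(2)[OF assms]
  proof (rule sum_hyp_poly_Vandermonde[OF degree_hyp_poly_le])
    fix k
    have pos: "pochhammer (\<alpha> + 1) k > 0" "pochhammer (\<alpha> + \<beta> + 2 + real j) k > 0"
      using assms by (auto intro!: pochhammer_pos)
    have "Gamma (\<alpha> + 1 + real k) = Gamma (\<alpha> + 1) * pochhammer (\<alpha> + 1) k"
      "Gamma (\<alpha> + 1 + real k + (\<beta> + 1 + real j)) =
        Gamma (\<alpha> + 1 + (\<beta> + 1 + real j)) * pochhammer (\<alpha> + \<beta> + 2 + real j) k"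
      using pochhammer_Gamma_real[of "\<alpha> + 1" k] pochhammer_Gamma_real[of "\<alpha> + \<beta> + 2 + real j" k] assms
      by (simp_all add: algebra_simps)
    then have "Beta (\<alpha> + 1 + real k) (\<beta> + 1 + real j) =
        Beta (\<alpha> + 1) (\<beta> + 1 + real j) * (pochhammer (\<alpha> + 1) k / pochhammer (\<alpha> + \<beta> + 2 + real j) k)"
      by (simp add: Beta_def)
    then show "coeff (hyp_poly n [real n + \<alpha> + \<beta> + 1] [\<alpha> + 1]) k * Beta (\<alpha> + 1 + real k) (\<beta> + 1 + real j)
      = Beta (\<alpha> + 1) (\<beta> + 1 + real j) * (pochhammer (real n + \<alpha> + \<beta> + 1) k * pochhammer (- real n) k
        / (fact k * pochhammer (\<alpha> + \<beta> + 2 + real j) k))"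
      using pos by (simp add: coeff_hyp_poly)
  qed (use assms in auto)
  then show ?thesis by (simp add: algebra_simps)
qed

text \<open>The factor x^j shifts \<alpha>, so the moments are proportional to (\<alpha>+1+j)_k.
  This supplies the upper parameter a of Chu-Vandermonde, with c = \<alpha>+1 and hence c - a =
  -j.\<close>

lemma Laguerre_hyp_poly_power_integral:
  fixes \<alpha> :: real
  assumes "\<alpha> > -1"
  shows "(LBINT x:{0<..}. poly (hyp_poly n [] [\<alpha> + 1]) x * (x ^ j * (x powr \<alpha> * exp (- x))))
     = Gamma (\<alpha> + 1 + real j) * (pochhammer (- real j) n / pochhammer (\<alpha> + 1) n)"
proof -
  have mom: "set_integrable lborel {0<..} (\<lambda>x. x ^ k * (x ^ j * (x powr \<alpha> * exp (- x))))"
    "(LBINT x:{0<..}. x ^ k * (x ^ j * (x powr \<alpha> * exp (- x)))) = Gamma (\<alpha> + 1 + real j + real k)" for k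
    using Gamma_moments[OF assms, of "k + j"] by (simp_all add: power_add mult.assoc mult_ac add_ac)
  have "(LBINT x:{0<..}. poly (hyp_poly n [] [\<alpha> + 1]) x * (x ^ j * (x powr \<alpha> * exp (- x))))
     = Gamma (\<alpha> + 1 + real j) * (pochhammer (\<alpha> + 1 - (\<alpha> + 1 + real j)) n / pochhammer (\<alpha> + 1) n)"
    unfolding set_integral_weighted_poly(2)[OF mom(1)] mom(2)
    by (rule sum_hyp_poly_Vandermonde[OF degree_hyp_poly_le])
      (use assms in \<open>simp_all add: coeff_hyp_poly pochhammer_Gamma_real[of "\<alpha> + 1 + real j"] mult_ac\<close>)
  then show ?thesis by simp
qed

section \<open>Jacobi and Laguerre orthogonality\<close>

text \<open>The abstract criterion for the functional J sending p to its integral against w;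
  integrability makes J additive.\<close>

lemma orthogonal_set_integrals:
  fixes P :: "nat \<Rightarrow> real poly" and w :: "real \<Rightarrow> real"
  assumes int: "\<And>p. set_integrable lborel S (\<lambda>x. poly p x * w x)"
    and "pcompose q q = [:0, 1:]" "degree q \<le> 1" "\<And>n. degree (P n) \<le> n"
    and "\<And>n j. j < n \<Longrightarrow> (LBINT x:S. poly (P n) x * (poly q x ^ j * w x)) = 0"
    and "\<And>n. coeff (pcompose (P n) q) n * (LBINT x:S. poly (P n) x * (poly q x ^ n * w x)) > 0"
  shows "\<exists>h :: nat \<Rightarrow> real. (\<forall>n. h n > 0) \<and>
    (\<forall>n m. (LBINT x:S. poly (P n * P m) x * w x) = (if n = m then h n else 0))"
proof -
  define J where "J p = (LBINT x:S. poly p x * w x)" for p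
  have J_pow: "J (q ^ j * P n) = (LBINT x:S. poly (P n) x * (poly q x ^ j * w x))" for j n
    by (simp add: J_def mult_ac)
  have J_linear: "J (p + r) = J p + J r" "J (Polynomial.smult a p) = a * J p" for p r a
    using set_integral_add(2)[OF int[of p] int[of r]]
    by (simp_all add: J_def algebra_simps)
  have J: "n \<noteq> m \<Longrightarrow> J (P n * P m) = 0" "J (P n * P n) > 0" for n m
    using orthogonal_if_orthogonal_to_powers[of J q P] J_linear assms(2-6)
    by (auto simp: J_pow)
  show ?thesis
    by (rule exI[of _ "\<lambda>n. J (P n * P n)"]) (use J in \<open>simp add: J_def\<close>)
qed

text \<open>The symbol (1+j-n)_n in the power integral has a zero factor for j < n and equals n! for
  j = n.\<close>

lemma Jacobi_orthogonality:
  fixes \<alpha> \<beta> :: real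
  assumes "\<alpha> > -1" "\<beta> > -1"
  defines "P \<equiv> \<lambda>n. hyp_poly n [real n + \<alpha> + \<beta> + 1] [\<alpha> + 1]"
  shows "\<exists>A :: nat \<Rightarrow> real. (\<forall>n. A n > 0) \<and>
    (\<forall>n m. (LBINT x:{0<..<1}. poly (P n * P m) x * (x powr \<alpha> * (1 - x) powr \<beta>))
      = (if n = m then A n else 0))"
proof (rule orthogonal_set_integrals[where q = "[:1, - 1:]"])
  show "set_integrable lborel {0<..<1} (\<lambda>x. poly p x * (x powr \<alpha> * (1 - x) powr \<beta>))" for p
    using set_integral_weighted_poly(1)[OF Beta_moments(1)[OF assms(1,2), of _ 0]] by simp
  show "degree (P n) \<le> n" for n
    by (simp add: P_def degree_hyp_poly_le)
  note int = Jacobi_hyp_poly_power_integral[OF assms(1,2)]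
  show "(LBINT x:{0<..<1}. poly (P n) x * (poly [:1, - 1:] x ^ j * (x powr \<alpha> * (1 - x) powr \<beta>))) = 0"
    if "j < n" for n j
  proof -
    \<comment> \<open>Negating a natural number below n brings the base into the form of the
      vanishing criterion.\<close>
    have "1 + real j - real n = - real (n - 1 - j)"
      using that by simp
    then have "pochhammer (1 + real j - real n) n = 0"
      using that by (simp only: pochhammer_of_nat_eq_0_iff)
    then show ?thesis using int[of n j] by (simp add: P_def)
  qed
  show "coeff (pcompose (P n) [:1, - 1:]) n *
    (LBINT x:{0<..<1}. poly (P n) x * (poly [:1, - 1:] x ^ n * (x powr \<alpha> * (1 - x) powr \<beta>))) > 0" for n
  proof -
    let ?c = "pochhammer (real n + \<alpha> + \<beta> + 1) n / pochhammer (\<alpha> + 1) n"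
    let ?I = "Beta (\<alpha> + 1) (\<beta> + 1 + real n) * (fact n / pochhammer (\<alpha> + \<beta> + 2 + real n) n)"
    \<comment> \<open>For n = 0 the base \<alpha>+\<beta>+1 may be negative, but the symbol is 1;
      for n >= 1 the base is positive.\<close>
    have "?c > 0"
      using assms by (cases n) (auto intro!: divide_pos_pos pochhammer_pos)
    moreover have "?I > 0"
      using assms by (auto simp: Beta_def intro!: divide_pos_pos mult_pos_pos pochhammer_pos)
    ultimately have "?c * ?I > 0"
      by (rule mult_pos_pos)
    moreover have "coeff (pcompose (P n) [:1, - 1:]) n = ?c"
    proof -
      \<comment> \<open>This sign, from (-n)_n = (-1)^n n!, cancels the one produced by substituting
        1 - x.\<close>
      have "coeff (P n) n = (- 1) ^ n * ?c"
        by (simp add: P_def coeff_hyp_poly pochhammer_same)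
      moreover have "(- 1) ^ n * ((- 1) ^ n * ?c) = ?c"
        by (simp flip: power_mult_distrib mult.assoc)
      ultimately show ?thesis
        using coeff_pcompose_affine_top[of "P n" n "- 1" 1] by (simp add: P_def degree_hyp_poly_le)
    qed
    moreover have "(LBINT x:{0<..<1}. poly (P n) x * (poly [:1, - 1:] x ^ n * (x powr \<alpha> * (1 - x) powr \<beta>))) = ?I"
      using int[of n n] by (simp add: P_def pochhammer_fact)
    ultimately show ?thesis
      by (simp only:)
  qed
qed (auto simp: pcompose_pCons)

lemma Laguerre_orthogonality:
  fixes \<alpha> :: real
  assumes "\<alpha> > -1"
  defines "P \<equiv> \<lambda>n. hyp_poly n [] [\<alpha> + 1]"
  shows "\<exists>B :: nat \<Rightarrow> real. (\<forall>n. B n > 0) \<and>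
    (\<forall>n m. (LBINT x:{0<..}. poly (P n * P m) x * (x powr \<alpha> * exp (- x)))
      = (if n = m then B n else 0))"
proof (rule orthogonal_set_integrals[where q = "[:0, 1:]"])
  show "set_integrable lborel {0<..} (\<lambda>x. poly p x * (x powr \<alpha> * exp (- x)))" for p
    by (rule set_integral_weighted_poly(1)[OF Gamma_moments(1)[OF assms(1)]])
  show "degree (P n) \<le> n" for n
    by (simp add: P_def degree_hyp_poly_le)
  note int = Laguerre_hyp_poly_power_integral[OF assms(1)]
  show "(LBINT x:{0<..}. poly (P n) x * (poly [:0, 1:] x ^ j * (x powr \<alpha> * exp (- x)))) = 0"
    if "j < n" for n j
    using that int[of n j] by (simp add: P_def pochhammer_of_nat_eq_0_iff)
  show "coeff (pcompose (P n) [:0, 1:]) n *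
    (LBINT x:{0<..}. poly (P n) x * (poly [:0, 1:] x ^ n * (x powr \<alpha> * exp (- x)))) > 0" for n
  proof -
    \<comment> \<open>The leading coefficient is \<open>?r\<close> / n! and the integral is a Gamma
      value times \<open>?r\<close>, so the sign of \<open>?r\<close> disappears in the
      square.\<close>
    let ?r = "pochhammer (- real n) n / pochhammer (\<alpha> + 1) n"
    have "?r \<noteq> 0" "Gamma (\<alpha> + 1 + real n) > 0"
      using assms by (auto simp: pochhammer_of_nat_eq_0_iff pochhammer_eq_0_iff)
    then have "?r\<^sup>2 * (Gamma (\<alpha> + 1 + real n) / fact n) > 0"
      by (intro mult_pos_pos divide_pos_pos) auto
    also have "?r\<^sup>2 * (Gamma (\<alpha> + 1 + real n) / fact n) = coeff (P n) n * (Gamma (\<alpha> + 1 + real n) * ?r)"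
      by (simp add: P_def coeff_hyp_poly power2_eq_square mult_ac)
    finally show ?thesis
      using int[of n n] by (simp add: P_def)
  qed
qed (auto simp: pcompose_pCons)

theorem theorem3:
  fixes \<rho> :: nat and \<alpha> \<beta> :: real and \<delta> :: "nat \<Rightarrow> real" and \<kappa> :: "nat \<Rightarrow> nat"
    and K :: nat and c :: "nat \<Rightarrow> real poly"
  assumes "\<rho> \<ge> 1" and "\<alpha> > -1" and "\<beta> > -1"
    and "\<And>i. i \<in> {1..\<rho>} \<Longrightarrow> \<delta> i > -1"
    and "\<And>i. i \<in> {1..\<rho>} \<Longrightarrow> \<kappa> i \<ge> 1"
  defines "K \<equiv> \<Sum>i=1..\<rho>. \<kappa> i"
  defines "c \<equiv> diffop_coeffs (D_hat \<delta> \<kappa> \<rho>) K"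
  shows "\<exists>A B :: nat \<Rightarrow> real. (\<forall>n. A n > 0) \<and> (\<forall>n. B n > 0) \<and>
    (\<forall>n m.
      (let f = (\<lambda>x. sobolev_form c K (P_fun \<rho> \<alpha> \<beta> \<delta> \<kappa> n) (P_fun \<rho> \<alpha> \<beta> \<delta> \<kappa> m) x
                     * (x powr \<alpha> * (1 - x) powr \<beta>))
       in set_integrable lborel {0<..<1} f \<and>
          (LBINT x:{0<..<1}. f x) = (if n = m then A n else 0)) \<and>
      (let g = (\<lambda>x. sobolev_form c K (L_fun \<rho> \<alpha> \<delta> \<kappa> n) (L_fun \<rho> \<alpha> \<delta> \<kappa> m) x
                     * (x powr \<alpha> * exp (- x)))
       in set_integrable lborel {0<..} g \<and>
          (LBINT x:{0<..}. g x) = (if n = m then B n else 0)))"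
proof -
  let ?P = "\<lambda>n. hyp_poly n [real n + \<alpha> + \<beta> + 1] [\<alpha> + 1]" and ?L = "\<lambda>n. hyp_poly n [] [\<alpha> + 1]"
  have c: "is_diffop_coeffs (D_hat \<delta> \<kappa> \<rho>) K c"
    unfolding c_def by (rule is_diffop_coeffs_D_hat) (use assms(4) in \<open>auto simp: K_def\<close>)
  have D: "D_hat \<delta> \<kappa> \<rho> (hyp_poly n (as @ map (\<lambda>i. \<delta> i + 1) [1..<\<rho> + 1])
      ([\<alpha> + 1] @ map (\<lambda>i. real (\<kappa> i) + \<delta> i + 1) [1..<\<rho> + 1])) = hyp_poly n as [\<alpha> + 1]" for n as
    by (rule D_hat_hyp_poly) (use assms(4) in auto)
  \<comment> \<open>Detaching the head -n and the mapped parameter lists leaves \<open>as\<close> =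
    [n+\<alpha>+\<beta>+1] in \<open>D\<close>.\<close>
  have P: "sobolev_form c K (P_fun \<rho> \<alpha> \<beta> \<delta> \<kappa> n) (P_fun \<rho> \<alpha> \<beta> \<delta> \<kappa> m) x = poly (?P n * ?P m) x" for n m x
    unfolding P_fun_def append.simps(2) hypergeometric_eq_poly sobolev_form_poly[OF c]
    using D[of n "[real n + \<alpha> + \<beta> + 1]"] D[of m "[real m + \<alpha> + \<beta> + 1]"] by (simp del: upt_Suc)
  have L: "sobolev_form c K (L_fun \<rho> \<alpha> \<delta> \<kappa> n) (L_fun \<rho> \<alpha> \<delta> \<kappa> m) x = poly (?L n * ?L m) x" for n m x
    unfolding L_fun_def append.simps(2) hypergeometric_eq_poly sobolev_form_poly[OF c]
    using D[of n "[]"] D[of m "[]"] by (simp del: upt_Suc)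
  \<comment> \<open>The 0 sets j = 0 in \<open>Beta_moments\<close>, which leaves the bare
    weight.\<close>
  have int: "set_integrable lborel {0<..<1} (\<lambda>x. poly p x * (x powr \<alpha> * (1 - x) powr \<beta>))"
    "set_integrable lborel {0<..} (\<lambda>x. poly p x * (x powr \<alpha> * exp (- x)))" for p
    using set_integral_weighted_poly(1)[OF Beta_moments(1)[OF assms(2,3), of _ 0]]
      set_integral_weighted_poly(1)[OF Gamma_moments(1)[OF assms(2)]] by simp_all
  obtain A where A: "\<And>n. A n > (0 :: real)"
    "\<And>n m. (LBINT x:{0<..<1}. poly (?P n * ?P m) x * (x powr \<alpha> * (1 - x) powr \<beta>))
      = (if n = m then A n else 0)"
    using Jacobi_orthogonality[OF assms(2,3)] by blast
  obtain B where B: "\<And>n. B n > (0 :: real)"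
    "\<And>n m. (LBINT x:{0<..}. poly (?L n * ?L m) x * (x powr \<alpha> * exp (- x)))
      = (if n = m then B n else 0)"
    using Laguerre_orthogonality[OF assms(2)] by blast
  show ?thesis
    unfolding P L Let_def
    by (intro exI[of _ A] exI[of _ B]) (use A B int in blast)
qed

end
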